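(* Let $d_1, d_2 \ge 1$ be integers and let $G$ be a graph with $n \ge 5$ nodes, with node weights $\mathbf{w}_i = (w^1_i,\ldots,w^{d_1}_i) \in \mathbb{R}^{d_1}$ and edge weights $\mathbf{g}_{\{i,j\}} = (g^1_{\{i,j\}},\ldots,g^{d_2}_{\{i,j\}}) \in \mathbb{R}^{d_2}$ ($i \ne j$). Assume that $$w^l_i + w^l_j + w^{l+1}_j + w^{l+1}_k \ne w^l_m + w^l_p + w^{l+1}_q + w^{l+1}_r \quad \text{for all } l = 1,\ldots,d_1-1,$$ $$g^l_{\{i,j\}} + g^{l+1}_{\{j,k\}} \ne g^l_{\{m,p\}} + g^{l+1}_{\{q,r\}} \quad \text{for all } l = 1,\ldots,d_2-1,$$ $$w^1_i + w^1_j + g^1_{\{j,k\}} \ne w^1_m + w^1_p + g^1_{\{q,r\}},$$ for any pairwise distinct $i,j,k \in \{1,\ldots,n\}$ and any pairwise distinct $m,p,q,r \in \{1,\ldots,n\}$. Then $G$ is reconstructible from the following distributions: $\mathcal{D}_{w^l}(G)$ for $l = 1,\ldots,d_1$; $\mathcal{D}_{\beta^{l,l+1}}(G)$ for $l = 1,\ldots,d_1-1$; $\mathcal{D}_{g^l}(G)$ for $l = 1,\ldots,d_2$; $\mathcal{D}_{\alpha^{l,l+1}}(G)$ for $l=1,\ldots,d_2-1$; and $\mathcal{D}_{\Delta^1}(G)$. That is, every graph $G'$ with $n$ nodes, node weights in $\mathbb{R}^{d_1}$ and edge weights in $\mathbb{R}^{d_2}$ for which each of these distributions coincides with the corresponding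 one for $G$ is isomorphic to $G$.
   Context: Here a graph $G$ with $n$ nodes, node weights in $\mathbb{R}^{d_1}$ and edge weights in $\mathbb{R}^{d_2}$ is a complete graph on $\{1,\ldots,n\}$ with a vector $\mathbf{w}_i \in \mathbb{R}^{d_1}$ assigned to each node $i$ and a vector $\mathbf{g}_{\{i,j\}} \in \mathbb{R}^{d_2}$ assigned to each two-element subset $\{i,j\}$. Two such graphs, with weights $\mathbf{w}_i, \mathbf{g}_{\{i,j\}}$ and $\mathbf{w}'_i, \mathbf{g}'_{\{i,j\}}$, are isomorphic if there is a permutation $\pi \in S_n$ with $\mathbf{w}'_i = \mathbf{w}_{\pi(i)}$ for all $i$ and $\mathbf{g}'_{\{i,j\}} = \mathbf{g}_{\{\pi(i),\pi(j)\}}$ for all $i \ne j$. A distribution means a multiset, i.e. a set with a positive integer multiplicity for each element. $\mathcal{D}_{w^l}(G)$ is the multiset of all $w^l_i$, $i=1,\ldots,n$; $\mathcal{D}_{g^l}(G)$ is the multiset of all $g^l_{\{i,j\}}$ over the two-element subsets $\{i,j\} \subseteq \{1,\ldots,n\}$. For pairwise distinct $i,j,k$ put $$\beta^{l,l+1}_{i,j,k} = w^l_i + w^l_j + w^{l+1}_j + w^{l+1}_k, \qquad \alpha^{l,l+1}_{i,j,k} = g^l_{\{i,j\}} + g^{l+1}_{\{j,k\}}, \qquad \Delta^1_{i,j,k} = w^1_i + w^1_j + g^1_{\{j,k\}}.$$ $\mathcal{D}_{\beta^{l,l+1}}(G)$, $\mathcal{D}_{\alpha^{l,l+1}}(G)$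 and $\mathcal{D}_{\Delta^1}(G)$ are the multisets of all $\beta^{l,l+1}_{i,j,k}$, all $\alpha^{l,l+1}_{i,j,k}$ and all $\Delta^1_{i,j,k}$, respectively, taken over all pairwise distinct $i,j,k \in \{1,\ldots,n\}$. *)

theory Defs
  imports Complex_Main "HOL-Library.Multiset" "HOL-Combinatorics.Permutations"
begin

text \<open>
  A graph on the nodes \<open>1, \<dots>, n\<close> with \<open>d1\<close>-dimensional node weights and \<open>d2\<close>-dimensional edge
  weights. Since \<open>n\<close>, \<open>d1\<close>, \<open>d2\<close> are numbers rather than types, the weights are total
  functions: \<open>node_weight G i l\<close> is the \<open>l\<close>-th coordinate of the weight of node \<open>i\<close>, and
  \<open>edge_weight G {i, j} l\<close> that of the edge \<open>{i, j}\<close>. Only the values at nodes in \<open>{1..n}\<close>, at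
  two-element subsets of \<open>{1..n}\<close>, and at coordinates in \<open>{1..d1}\<close> or \<open>{1..d2}\<close> belong to the graph;
  nothing below depends on any other value.
\<close>

record weighted_graph =
  node_weight :: "nat \<Rightarrow> nat \<Rightarrow> real"
  edge_weight :: "nat set \<Rightarrow> nat \<Rightarrow> real"

definition edges :: "nat \<Rightarrow> nat set set" where
  "edges n = {e. e \<subseteq> {1..n} \<and> card e = 2}"

definition triples :: "nat \<Rightarrow> (nat \<times> nat \<times> nat) set" where
  "triples n = {(i, j, k). {i, j, k} \<subseteq> {1..n} \<and> distinct [i, j, k]}"

definition isomorphic :: "nat \<Rightarrow> nat \<Rightarrow> nat \<Rightarrow> weighted_graph \<Rightarrow> weighted_graph \<Rightarrow> bool" where
  "isomorphic n d1 d2 G G' \<longleftrightarrow> (\<exists>\<pi>. \<pi> permutes {1..n} \<and>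
     (\<forall>i\<in>{1..n}. \<forall>l\<in>{1..d1}. node_weight G' i l = node_weight G (\<pi> i) l) \<and>
     (\<forall>i\<in>{1..n}. \<forall>j\<in>{1..n}. i \<noteq> j \<longrightarrow>
        (\<forall>l\<in>{1..d2}. edge_weight G' {i, j} l = edge_weight G {\<pi> i, \<pi> j} l)))"

definition beta :: "weighted_graph \<Rightarrow> nat \<Rightarrow> nat \<Rightarrow> nat \<Rightarrow> nat \<Rightarrow> real" where
  "beta G l i j k =
     node_weight G i l + node_weight G j l + node_weight G j (l + 1) + node_weight G k (l + 1)"

definition alpha :: "weighted_graph \<Rightarrow> nat \<Rightarrow> nat \<Rightarrow> nat \<Rightarrow> nat \<Rightarrow> real" where
  "alpha G l i j k = edge_weight G {i, j} l + edge_weight G {j, k} (l + 1)"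

definition Delta1 :: "weighted_graph \<Rightarrow> nat \<Rightarrow> nat \<Rightarrow> nat \<Rightarrow> real" where
  "Delta1 G i j k = node_weight G i 1 + node_weight G j 1 + edge_weight G {j, k} 1"

definition D_w :: "nat \<Rightarrow> nat \<Rightarrow> weighted_graph \<Rightarrow> real multiset" where
  "D_w n l G = {# node_weight G i l. i \<in># mset_set {1..n} #}"

definition D_g :: "nat \<Rightarrow> nat \<Rightarrow> weighted_graph \<Rightarrow> real multiset" where
  "D_g n l G = {# edge_weight G e l. e \<in># mset_set (edges n) #}"

definition D_beta :: "nat \<Rightarrow> nat \<Rightarrow> weighted_graph \<Rightarrow> real multiset" where
  "D_beta n l G = {# beta G l i j k. (i, j, k) \<in># mset_set (triples n) #}"

definition D_alpha :: "nat \<Rightarrow> nat \<Rightarrow> weighted_graph \<Rightarrow> real multiset" where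
  "D_alpha n l G = {# alpha G l i j k. (i, j, k) \<in># mset_set (triples n) #}"

definition D_Delta1 :: "nat \<Rightarrow> weighted_graph \<Rightarrow> real multiset" where
  "D_Delta1 n G = {# Delta1 G i j k. (i, j, k) \<in># mset_set (triples n) #}"

definition reconstructible_from ::
    "nat \<Rightarrow> nat \<Rightarrow> nat \<Rightarrow> (weighted_graph \<Rightarrow> real multiset) set \<Rightarrow> weighted_graph \<Rightarrow> bool" where
  "reconstructible_from n d1 d2 \<D> G \<longleftrightarrow>
     (\<forall>G'. (\<forall>D\<in>\<D>. D G' = D G) \<longrightarrow> isomorphic n d1 d2 G G')"

end

theory Submission
  imports Defs
begin

text \<open>
  Equality of the one-coordinate distributions of \<open>G\<close> and \<open>G'\<close> only says that each coordinate of
  \<open>G'\<close> is a rearrangement of that coordinate of \<open>G\<close>: by a permutation of the nodes for node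
  weights, of the edges for edge weights. All these rearrangements must be shown to come from one
  permutation of the nodes. Take \<open>\<pi>\<close> to be the one that rearranges the first node coordinate.
  Each of the distributions \<open>\<Delta>\<^sup>1\<close>, \<open>\<beta>\<close>, \<open>\<alpha>\<close> then carries \<open>\<pi>\<close> from one coordinate to another: from
  the first node coordinate to the first edge coordinate, and from each coordinate to the next.

  The carrying works identically in the three cases. Each distribution consists of the
  values \<open>u {i, j} + g {j, k}\<close>, where \<open>u\<close> and \<open>g\<close> are functions of edges: an edge weight, or the sum
  of a node weight over the two end points. Suppose that \<open>u\<close> is rearranged by \<open>\<pi>\<close> and \<open>g\<close> by
  an unknown map \<open>\<sigma>\<close> of edges. The value in \<open>G'\<close> at \<open>(i, j, k)\<close> is \<open>u {\<pi> i, \<pi> j} + g (\<sigma> {j, k})\<close>, and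
  it occurs in the distribution of \<open>G\<close>. By hypothesis the sum of \<open>u\<close> and \<open>g\<close> at disjoint edges
  never does. So \<open>{\<pi> i, \<pi> j}\<close> meets \<open>\<sigma> {j, k}\<close>, for each of the at least three nodes \<open>i\<close> other than
  \<open>j\<close> and \<open>k\<close>. The edge \<open>\<sigma> {j, k}\<close> has only two end points, so one of them is \<open>\<pi> j\<close>; by
  symmetry the other one is \<open>\<pi> k\<close>, that is, \<open>\<sigma> {j, k} = {\<pi> j, \<pi> k}\<close>
  (lemma \<open>matching_induced_by_nodes\<close>).
\<close>

section \<open>Edges and triples of nodes\<close>

lemma edgesI: "i \<in> {1..n} \<Longrightarrow> j \<in> {1..n} \<Longrightarrow> i \<noteq> j \<Longrightarrow> {i, j} \<in> edges n"
  by (auto simp: edges_def)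

lemma edgesE:
  assumes "e \<in> edges n"
  obtains i j where "i \<in> {1..n}" "j \<in> {1..n}" "i \<noteq> j" "e = {i, j}"
  using assms by (auto simp: edges_def card_2_iff)

lemma finite_edges: "finite (edges n)"
  unfolding edges_def by (rule finite_subset[of _ "Pow {1..n}"]) auto

lemma finite_triples: "finite (triples n)"
  by (rule finite_subset[of _ "{1..n} \<times> {1..n} \<times> {1..n}"]) (auto simp: triples_def)

lemma in_mset_triples:
  "(i, j, k) \<in># mset_set (triples n) \<longleftrightarrow> {i, j, k} \<subseteq> {1..n} \<and> distinct [i, j, k]"
  by (simp add: finite_triples) (simp add: triples_def)

lemma image_edge:
  assumes "\<pi> permutes {1..n}" "e \<in> edges n"
  shows "\<pi> ` e \<in> edges n"
  using assms permutes_image[OF assms(1)] by (auto simp: edges_def card_image permutes_inj_on)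

section \<open>Carrying a node permutation from one coordinate to another\<close>

text \<open>The pigeonhole principle: a two-element set cannot contain \<open>\<pi> i\<close> for three nodes \<open>i\<close>.\<close>

lemma common_node_in_edge:
  assumes n: "n \<ge> 5" and \<pi>: "\<pi> permutes {1..n}" and f: "f \<in> edges n"
    and meets: "\<And>i. i \<in> {1..n} - {j, k} \<Longrightarrow> {\<pi> i, \<pi> j} \<inter> f \<noteq> {}"
  shows "\<pi> j \<in> f"
proof (rule ccontr)
  assume "\<pi> j \<notin> f"
  then have "\<pi> ` ({1..n} - {j, k}) \<subseteq> f"
    using meets by blast
  moreover have card_f: "card f = 2" and "finite f"
    using f by (auto simp: edges_def intro: finite_subset)
  ultimately have "card (\<pi> ` ({1..n} - {j, k})) \<le> 2"
    by (metis card_mono)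
  moreover have "card (\<pi> ` ({1..n} - {j, k})) = card ({1..n} - {j, k})"
    using \<pi> by (intro card_image) (rule permutes_inj_on)
  moreover have "card ({1..n} - {j, k}) \<ge> n - 2"
    using diff_card_le_card_Diff[of "{j, k}" "{1..n}"] card_insert_le_m1[of 2 "{k}" j] by simp
  ultimately show False
    using n by linarith
qed

text \<open>
  This lemma carries \<open>\<pi>\<close> from one coordinate to another. It serves all three kinds of distribution
  because \<open>u\<close> and \<open>g\<close> are arbitrary functions of edges. If \<open>{\<pi> i, \<pi> j}\<close> and \<open>\<sigma> {j, k}\<close> were disjoint,
  then \<open>separated\<close> would exclude from the distribution of \<open>u\<close> and \<open>g\<close> a value that \<open>same_values\<close> puts
  there; so they meet for all \<open>i\<close>, and the pigeonhole principle applies at both end points of \<open>{j, k}\<close>.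
\<close>

lemma matching_induced_by_nodes:
  fixes u u' g g' :: "nat set \<Rightarrow> real"
  assumes n: "n \<ge> 5" and \<pi>: "\<pi> permutes {1..n}"
    and u': "\<And>e. e \<in> edges n \<Longrightarrow> u' e = u (\<pi> ` e)"
    and \<sigma>: "\<And>e. e \<in> edges n \<Longrightarrow> \<sigma> e \<in> edges n"
    and g': "\<And>e. e \<in> edges n \<Longrightarrow> g' e = g (\<sigma> e)"
    and same_values: "{# u' {i, j} + g' {j, k}. (i, j, k) \<in># mset_set (triples n) #} =
      {# u {i, j} + g {j, k}. (i, j, k) \<in># mset_set (triples n) #}"
    and separated: "\<And>i j k m p q r. \<lbrakk>{i, j, k} \<subseteq> {1..n}; distinct [i, j, k];
      {m, p, q, r} \<subseteq> {1..n}; distinct [m, p, q, r]\<rbrakk> \<Longrightarrow>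
      u {i, j} + g {j, k} \<noteq> u {m, p} + g {q, r}"
    and e: "e \<in> edges n"
  shows "\<sigma> e = \<pi> ` e"
proof -
  have meets: "{\<pi> i, \<pi> j} \<inter> \<sigma> {j, k} \<noteq> {}" if ijk: "(i, j, k) \<in> triples n" for i j k
  proof
    assume disjoint: "{\<pi> i, \<pi> j} \<inter> \<sigma> {j, k} = {}"
    have ij: "{i, j} \<in> edges n" and jk: "{j, k} \<in> edges n"
      using ijk by (auto simp: triples_def intro!: edgesI)
    obtain q r where qr: "q \<in> {1..n}" "r \<in> {1..n}" "q \<noteq> r" "\<sigma> {j, k} = {q, r}"
      using edgesE[OF \<sigma>[OF jk]] by metis
    obtain m p where mp: "m \<in> {1..n}" "p \<in> {1..n}" "m \<noteq> p" "{\<pi> i, \<pi> j} = {m, p}"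
      using edgesE[OF image_edge[OF \<pi> ij]] by auto
    have "u' {i, j} + g' {j, k} \<in># {# u {i, j} + g {j, k}. (i, j, k) \<in># mset_set (triples n) #}"
      unfolding same_values[symmetric] using ijk finite_triples[of n] by force
    then obtain a b c where abc: "(a, b, c) \<in> triples n"
      and "u' {i, j} + g' {j, k} = u {a, b} + g {b, c}"
      using finite_triples[of n] by auto
    then have "u {a, b} + g {b, c} = u {m, p} + g {q, r}"
      using u'[OF ij] g'[OF jk] mp(4) qr(4) by simp
    moreover have "distinct [m, p, q, r]"
      using disjoint mp qr by auto
    ultimately show False
      using separated[of a b c m p q r] abc mp qr by (auto simp: triples_def)
  qed
  obtain j k where jk: "j \<in> {1..n}" "k \<in> {1..n}" "j \<noteq> k" "e = {j, k}"
    using edgesE[OF e] by metis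
  have "\<pi> j \<in> \<sigma> e"
    using jk meets[of _ j k]
    by (intro common_node_in_edge[OF n \<pi> \<sigma>[OF e], of j k]) (auto simp: triples_def)
  moreover have "\<pi> k \<in> \<sigma> e"
    using jk meets[of _ k j]
    by (intro common_node_in_edge[OF n \<pi> \<sigma>[OF e], of k j])
       (auto simp: triples_def insert_commute)
  moreover have "\<pi> j \<noteq> \<pi> k"
    using jk permutes_inj[OF \<pi>] by (auto dest: injD)
  moreover obtain q r where "\<sigma> e = {q, r}"
    using edgesE[OF \<sigma>[OF e]] by metis
  ultimately show ?thesis
    using jk by auto
qed

text \<open>
  The form of the previous lemma for an edge coordinate \<open>g\<close>: there the matching \<open>\<sigma>\<close> exists because
  \<open>g\<close> and \<open>g'\<close> have the same distribution.
\<close>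

lemma edge_function_follows_nodes:
  fixes u u' g g' :: "nat set \<Rightarrow> real"
  assumes n: "n \<ge> 5" and \<pi>: "\<pi> permutes {1..n}"
    and u': "\<And>e. e \<in> edges n \<Longrightarrow> u' e = u (\<pi> ` e)"
    and same_weights: "image_mset g' (mset_set (edges n)) = image_mset g (mset_set (edges n))"
    and same_values: "{# u' {i, j} + g' {j, k}. (i, j, k) \<in># mset_set (triples n) #} =
      {# u {i, j} + g {j, k}. (i, j, k) \<in># mset_set (triples n) #}"
    and separated: "\<And>i j k m p q r. \<lbrakk>{i, j, k} \<subseteq> {1..n}; distinct [i, j, k];
      {m, p, q, r} \<subseteq> {1..n}; distinct [m, p, q, r]\<rbrakk> \<Longrightarrow>
      u {i, j} + g {j, k} \<noteq> u {m, p} + g {q, r}"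
    and e: "e \<in> edges n"
  shows "g' e = g (\<pi> ` e)"
proof -
  obtain \<sigma> where \<sigma>: "\<sigma> permutes edges n" "\<forall>e\<in>edges n. g' e = g (\<sigma> e)"
    using image_mset_eq_implies_permutes[OF finite_edges same_weights] by metis
  have "\<sigma> e = \<pi> ` e"
    by (rule matching_induced_by_nodes[OF n \<pi> u' _ _ same_values separated e])
       (use \<sigma> in \<open>auto simp: permutes_in_image\<close>)
  then show ?thesis
    using \<sigma>(2) e by simp
qed

text \<open>
  The form for a node coordinate, where \<open>\<sigma>\<close> is the action on edges of the node permutation \<open>\<tau>\<close> that
  rearranges \<open>v\<close>. A node permutation is determined by its action on edges, since \<open>{j}\<close> is the
  intersection of two edges.
\<close>

lemma node_function_follows_nodes:
  fixes w w' v v' :: "nat \<Rightarrow> real"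
  assumes n: "n \<ge> 5" and \<pi>: "\<pi> permutes {1..n}"
    and w': "\<And>i. i \<in> {1..n} \<Longrightarrow> w' i = w (\<pi> i)"
    and same_weights: "image_mset v' (mset_set {1..n}) = image_mset v (mset_set {1..n})"
    and same_values: "{# w' i + w' j + v' j + v' k. (i, j, k) \<in># mset_set (triples n) #} =
      {# w i + w j + v j + v k. (i, j, k) \<in># mset_set (triples n) #}"
    and separated: "\<And>i j k m p q r. \<lbrakk>{i, j, k} \<subseteq> {1..n}; distinct [i, j, k];
      {m, p, q, r} \<subseteq> {1..n}; distinct [m, p, q, r]\<rbrakk> \<Longrightarrow>
      w i + w j + v j + v k \<noteq> w m + w p + v q + v r"
    and j: "j \<in> {1..n}"
  shows "v' j = v (\<pi> j)"
proof -
  obtain \<tau> where \<tau>: "\<tau> permutes {1..n}" "\<forall>i\<in>{1..n}. v' i = v (\<tau> i)"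
    using image_mset_eq_implies_permutes[OF finite_atLeastAtMost same_weights] by metis
  have sum_image: "sum h' e = sum h (\<rho> ` e)"
    if "\<rho> permutes {1..n}" "\<forall>i\<in>{1..n}. h' i = h (\<rho> i)" "e \<in> edges n"
    for h h' :: "nat \<Rightarrow> real" and \<rho> e
    using that by (subst sum.reindex) (auto simp: edges_def permutes_inj_on intro!: sum.cong)
  have as_edge_sums: "{# sum x {i, j} + sum y {j, k}. (i, j, k) \<in># mset_set (triples n) #} =
      {# x i + x j + y j + y k. (i, j, k) \<in># mset_set (triples n) #}" for x y :: "nat \<Rightarrow> real"
    by (rule image_mset_cong) (auto simp: in_mset_triples)
  have \<tau>_edge: "\<tau> ` e = \<pi> ` e" if "e \<in> edges n" for e
  proof (rule matching_induced_by_nodes[OF n \<pi>, where u = "sum w" and u' = "sum w'"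
        and g = "sum v" and g' = "sum v'"])
    show "{# sum w' {i, j} + sum v' {j, k}. (i, j, k) \<in># mset_set (triples n) #} =
        {# sum w {i, j} + sum v {j, k}. (i, j, k) \<in># mset_set (triples n) #}"
      unfolding as_edge_sums by (rule same_values)
  next
    fix i j k m p q r
    assume ijk: "{i, j, k} \<subseteq> {1..n}" "distinct [i, j, k]"
      and mpqr: "{m, p, q, r} \<subseteq> {1..n}" "distinct [m, p, q, r]"
    show "sum w {i, j} + sum v {j, k} \<noteq> sum w {m, p} + sum v {q, r}"
      using separated[OF ijk mpqr] ijk mpqr by simp
  qed (use w' \<pi> \<tau> that in \<open>auto intro: sum_image image_edge\<close>)
  have "card ({1..n} - {j}) > Suc 0"
    using n j by simp
  then obtain k k' where k: "k \<in> {1..n} - {j}" "k' \<in> {1..n} - {j}" "k \<noteq> k'"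
    by (metis card_le_Suc0_iff_eq finite_Diff finite_atLeastAtMost linorder_not_less)
  have "\<tau> ` {j, k} = \<pi> ` {j, k}" "\<tau> ` {j, k'} = \<pi> ` {j, k'}"
    using j k by (auto intro!: \<tau>_edge edgesI simp del: image_insert)
  moreover have "\<pi> k \<noteq> \<pi> k'"
    using k permutes_inj[OF \<pi>] by (auto dest: injD)
  ultimately have "\<tau> j = \<pi> j"
    unfolding image_insert image_empty doubleton_eq_iff by metis
  then show ?thesis
    using \<tau>(2) j by simp
qed

section \<open>Reconstruction\<close>

theorem theorem3p7:
  fixes n d1 d2 :: nat and G :: weighted_graph
  assumes "d1 \<ge> 1" and "d2 \<ge> 1" and "n \<ge> 5"
    and "\<And>l i j k m p q r. \<lbrakk>l \<in> {1..<d1};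
           {i, j, k} \<subseteq> {1..n}; distinct [i, j, k];
           {m, p, q, r} \<subseteq> {1..n}; distinct [m, p, q, r]\<rbrakk> \<Longrightarrow>
         node_weight G i l + node_weight G j l + node_weight G j (l + 1) + node_weight G k (l + 1)
         \<noteq> node_weight G m l + node_weight G p l + node_weight G q (l + 1) + node_weight G r (l + 1)"
    and "\<And>l i j k m p q r. \<lbrakk>l \<in> {1..<d2};
           {i, j, k} \<subseteq> {1..n}; distinct [i, j, k];
           {m, p, q, r} \<subseteq> {1..n}; distinct [m, p, q, r]\<rbrakk> \<Longrightarrow>
         edge_weight G {i, j} l + edge_weight G {j, k} (l + 1)
         \<noteq> edge_weight G {m, p} l + edge_weight G {q, r} (l + 1)"
    and "\<And>i j k m p q r. \<lbrakk>
           {i, j, k} \<subseteq> {1..n}; distinct [i, j, k];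
           {m, p, q, r} \<subseteq> {1..n}; distinct [m, p, q, r]\<rbrakk> \<Longrightarrow>
         node_weight G i 1 + node_weight G j 1 + edge_weight G {j, k} 1
         \<noteq> node_weight G m 1 + node_weight G p 1 + edge_weight G {q, r} 1"
  shows "reconstructible_from n d1 d2
           ({D_w n l | l. l \<in> {1..d1}} \<union> {D_beta n l | l. l \<in> {1..<d1}} \<union>
            {D_g n l | l. l \<in> {1..d2}} \<union> {D_alpha n l | l. l \<in> {1..<d2}} \<union>
            {D_Delta1 n}) G"
proof -
  have "isomorphic n d1 d2 G G'"
    if same_w: "\<And>l. l \<in> {1..d1} \<Longrightarrow> D_w n l G' = D_w n l G"
      and same_beta: "\<And>l. l \<in> {1..<d1} \<Longrightarrow> D_beta n l G' = D_beta n l G"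
      and same_g: "\<And>l. l \<in> {1..d2} \<Longrightarrow> D_g n l G' = D_g n l G"
      and same_alpha: "\<And>l. l \<in> {1..<d2} \<Longrightarrow> D_alpha n l G' = D_alpha n l G"
      and same_Delta: "D_Delta1 n G' = D_Delta1 n G" for G'
  proof -
    obtain \<pi> where \<pi>: "\<pi> permutes {1..n}"
      and w1: "\<forall>i\<in>{1..n}. node_weight G' i 1 = node_weight G (\<pi> i) 1"
      using image_mset_eq_implies_permutes[OF finite_atLeastAtMost same_w[of 1, unfolded D_w_def]]
        \<open>d1 \<ge> 1\<close> by auto
    have w: "\<forall>i\<in>{1..n}. node_weight G' i l = node_weight G (\<pi> i) l" if "1 \<le> l" "l \<le> d1" for l
      using that
    proof (induction l rule: dec_induct)
      case base
      show ?case by (rule w1)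
    next
      case (step l)
      then have l: "l \<in> {1..<d1}" by simp
      have "node_weight G' i (l + 1) = node_weight G (\<pi> i) (l + 1)" if "i \<in> {1..n}" for i
      proof (rule node_function_follows_nodes[OF \<open>n \<ge> 5\<close> \<pi>, where w = "\<lambda>i. node_weight G i l"
            and w' = "\<lambda>i. node_weight G' i l" and v = "\<lambda>i. node_weight G i (l + 1)"])
        show "{# node_weight G' i (l + 1). i \<in># mset_set {1..n} #} =
            {# node_weight G i (l + 1). i \<in># mset_set {1..n} #}"
          using same_w[of "l + 1"] l by (simp add: D_w_def)
      qed (use step l that same_beta[OF l] assms(4)[OF l] in \<open>simp_all add: D_beta_def beta_def\<close>)
      then show ?case by simp
    qed
    have g: "\<forall>e\<in>edges n. edge_weight G' e l = edge_weight G (\<pi> ` e) l" if "1 \<le> l" "l \<le> d2" for l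
      using that
    proof (induction l rule: dec_induct)
      case base
      have sums: "{# sum (\<lambda>i. node_weight H i 1) {i, j} + edge_weight H {j, k} 1.
            (i, j, k) \<in># mset_set (triples n) #} = D_Delta1 n H" for H
        unfolding D_Delta1_def Delta1_def
        by (rule image_mset_cong) (auto simp: in_mset_triples)
      have "edge_weight G' e 1 = edge_weight G (\<pi> ` e) 1" if e: "e \<in> edges n" for e
      proof (rule edge_function_follows_nodes[OF \<open>n \<ge> 5\<close> \<pi>,
            where u = "sum (\<lambda>i. node_weight G i 1)" and u' = "sum (\<lambda>i. node_weight G' i 1)"])
        show "sum (\<lambda>i. node_weight G' i 1) e = sum (\<lambda>i. node_weight G i 1) (\<pi> ` e)"
          if "e \<in> edges n" for e
          using that \<pi> w1
          by (subst sum.reindex) (auto simp: edges_def permutes_inj_on intro!: sum.cong)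
        show "{# edge_weight G' e 1. e \<in># mset_set (edges n) #} =
            {# edge_weight G e 1. e \<in># mset_set (edges n) #}"
          using same_g[of 1] \<open>d2 \<ge> 1\<close> by (simp add: D_g_def)
        show "{# sum (\<lambda>i. node_weight G' i 1) {i, j} + edge_weight G' {j, k} 1.
              (i, j, k) \<in># mset_set (triples n) #} =
            {# sum (\<lambda>i. node_weight G i 1) {i, j} + edge_weight G {j, k} 1.
              (i, j, k) \<in># mset_set (triples n) #}"
          unfolding sums by (rule same_Delta)
      next
        fix i j k m p q r
        assume ijk: "{i, j, k} \<subseteq> {1..n}" "distinct [i, j, k]"
          and mpqr: "{m, p, q, r} \<subseteq> {1..n}" "distinct [m, p, q, r]"
        show "sum (\<lambda>i. node_weight G i 1) {i, j} + edge_weight G {j, k} 1 \<noteq>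
            sum (\<lambda>i. node_weight G i 1) {m, p} + edge_weight G {q, r} 1"
          using assms(6)[OF ijk mpqr] ijk mpqr by simp
      qed (rule e)
      then show ?case by simp
    next
      case (step l)
      then have l: "l \<in> {1..<d2}" by simp
      have "edge_weight G' e (l + 1) = edge_weight G (\<pi> ` e) (l + 1)" if "e \<in> edges n" for e
      proof (rule edge_function_follows_nodes[OF \<open>n \<ge> 5\<close> \<pi>,
            where u = "\<lambda>e. edge_weight G e l" and u' = "\<lambda>e. edge_weight G' e l"])
        show "{# edge_weight G' e (l + 1). e \<in># mset_set (edges n) #} =
            {# edge_weight G e (l + 1). e \<in># mset_set (edges n) #}"
          using same_g[of "l + 1"] l by (simp add: D_g_def)
      qed (use step l that same_alpha[OF l] assms(5)[OF l] in
          \<open>simp_all add: D_alpha_def alpha_def\<close>)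
      then show ?case by simp
    qed
    have "edge_weight G' {i, j} l = edge_weight G {\<pi> i, \<pi> j} l"
      if "i \<in> {1..n}" "j \<in> {1..n}" "i \<noteq> j" "l \<in> {1..d2}" for i j l
      using g[of l] edgesI[of i n j] that by force
    with \<pi> w show ?thesis
      unfolding isomorphic_def by (intro exI[of _ \<pi>]) auto
  qed
  then show ?thesis
    unfolding reconstructible_from_def by blast
qed

end
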